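(* Let $q$ be an integer with $2\leq q\leq 10{,}000$, let $p:=1/q$, and let $f(w):=w^p$ for $w\in[0,+\infty)$. For each $\delta>0$, let $g$ be the smoothing of $f$ associated with $\delta$, and let $\hat\lambda>0$ be the (unique) number with $f'(\hat\lambda)=g'(0)$, that is, $$\hat\lambda=(f')^{-1}\!\left(\frac{3f(\delta)}{\delta}-2f'(\delta)+\frac{\delta f''(\delta)}{2}\right)=\delta\left(\frac{p^2-5p+6}{2p}\right)^{\frac{1}{p-1}}.$$ Then, for every $\delta>0$, $$f(w+\hat\lambda)-f(\hat\lambda)\ \leq\ g(w)\qquad\text{for all } w\in(0,\delta).$$
   Context: For $f(w)=w^p$ with $0<p<1$ and $\delta>0$, the smoothing $g$ of $f$ associated with $\delta$ is defined by $g(w):=w^p$ for $w\in[\delta,+\infty)$, and $g(w):=Aw^3+Bw^2+Cw$ for $w\in[0,\delta]$, where $$A=\tfrac12\delta^{p-3}(p^2-3p+2),\qquad B=-\delta^{p-2}(p^2-4p+3),\qquad C=\tfrac12\delta^{p-1}(p^2-5p+6).$$ (These are the unique constants for which the cubic $Aw^3+Bw^2+Cw$ agrees with $f$ in value, first derivative and second derivative at $w=\delta$.) In particular $g'(0)=C$. The function $h(w):=f(w+\hat\lambda)-f(\hat\lambda)$ is the "shifted root function" whose derivative at $0$ equals that of $g$. *)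

theory Defs
  imports "HOL-Analysis.Analysis"
begin

text \<open>All functions below are meant for arguments \<open>w \<ge> 0\<close>; their values at negative arguments
  are never used.\<close>

definition root_fun :: "real \<Rightarrow> real \<Rightarrow> real" where
  "root_fun p w = w powr p"

definition coeff_A :: "real \<Rightarrow> real \<Rightarrow> real" where
  "coeff_A p \<delta> = 1/2 * \<delta> powr (p - 3) * (p^2 - 3*p + 2)"

definition coeff_B :: "real \<Rightarrow> real \<Rightarrow> real" where
  "coeff_B p \<delta> = - (\<delta> powr (p - 2)) * (p^2 - 4*p + 3)"

definition coeff_C :: "real \<Rightarrow> real \<Rightarrow> real" where
  "coeff_C p \<delta> = 1/2 * \<delta> powr (p - 1) * (p^2 - 5*p + 6)"

definition smoothing :: "real \<Rightarrow> real \<Rightarrow> real \<Rightarrow> real" where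
  "smoothing p \<delta> w =
    (if w \<ge> \<delta> then root_fun p w
     else coeff_A p \<delta> * w^3 + coeff_B p \<delta> * w^2 + coeff_C p \<delta> * w)"

text \<open>The condition that \<open>l > 0\<close> and the derivative of the root function at \<open>l\<close> equals the derivative of
  the smoothing at \<open>0\<close>. The latter is one-sided, since the smoothing lives on \<open>{0..}\<close>.\<close>

definition matches_slope :: "real \<Rightarrow> real \<Rightarrow> real \<Rightarrow> bool" where
  "matches_slope p \<delta> l \<longleftrightarrow>
    0 < l \<and> (smoothing p \<delta> has_real_derivative deriv (root_fun p) l) (at 0 within {0..})"

definition lambda_hat :: "real \<Rightarrow> real \<Rightarrow> real" where
  "lambda_hat p \<delta> = (THE l. matches_slope p \<delta> l)"

end

(* Let D be the smoothing minus the shifted root function. By the choice of lambda we have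
   D(0) = D'(0) = 0, and since the cubic matches f to second order at delta, while f' decreases and
   f'' increases, D'(delta) >= 0 >= D''(delta). As D'''' = - f''''(w + lambda) >= 0, D'' is convex.
   If D' were negative somewhere, then D'' would be negative before that point and positive after
   it, hence, by convexity, positive at delta. So D' >= 0 and D >= 0. *)
theory Submission
  imports Defs
begin

text \<open>Later used with \<open>D1\<close> as \<open>F\<close> and \<open>D2\<close> as
  \<open>F'\<close>. A negative value of \<open>F\<close> between two nonnegative end values forces
  \<open>F'\<close> to be first negative and then positive, which a convex \<open>F'\<close> with
  \<open>F' b\<close> \<le> 0 cannot be.\<close>

lemma nonneg_of_convex_deriv:
  fixes F F' :: "real \<Rightarrow> real"
  assumes conv: "convex_on {a..b} F'"
    and der: "\<And>x. x \<in> {a..b} \<Longrightarrow> (F has_real_derivative F' x) (at x)"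
    and "0 \<le> F a" "0 \<le> F b" "F' b \<le> 0" and x: "x \<in> {a..b}"
  shows "0 \<le> F x"
proof (rule ccontr)
  assume neg: "\<not> 0 \<le> F x"
  with assms have ax: "a < x" and xb: "x < b"
    by (auto simp: order_less_le)
  obtain u where u: "a < u" "u < x" "F x - F a = (x - a) * F' u"
    using MVT2[OF ax, of F F'] der x by auto
  obtain v where v: "x < v" "v < b" "F b - F x = (b - x) * F' v"
    using MVT2[OF xb, of F F'] der x by auto
  have "(x - a) * F' u < 0" "0 < (b - x) * F' v"
    using u v neg assms by auto
  then have "F' u < 0" "0 < F' v"
    using ax xb by (auto simp: mult_less_0_iff zero_less_mult_iff)
  \<comment> \<open>Since \<open>v\<close> lies between \<open>u\<close> and \<open>b\<close>,
    convexity bounds \<open>F' v\<close> by the larger of two nonpositive values.\<close>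
  moreover have "F' v \<le> max (F' u) (F' b)"
    using u v x by (intro convex_on_le_max convex_on_subset[OF conv]) auto
  ultimately show False
    using \<open>F' b \<le> 0\<close> by auto
qed

lemma DERIV_root_fun:
  "0 < w \<Longrightarrow> (root_fun p has_real_derivative p * w powr (p - 1)) (at w)"
  unfolding root_fun_def by (rule has_real_derivative_powr)

lemma deriv_root_fun: "0 < w \<Longrightarrow> deriv (root_fun p) w = p * w powr (p - 1)"
  by (rule DERIV_imp_deriv) (rule DERIV_root_fun)

lemma deriv2_root_fun:
  assumes "0 < w"
  shows "deriv (deriv (root_fun p)) w = p * (p - 1) * w powr (p - 2)"
proof (rule DERIV_imp_deriv)
  have "((\<lambda>w. p * w powr (p - 1)) has_real_derivative p * (p - 1) * w powr (p - 2)) (at w)"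
    using assms by (auto intro!: derivative_eq_intros)
  then show "(deriv (root_fun p) has_real_derivative p * (p - 1) * w powr (p - 2)) (at w)"
    by (rule has_field_derivative_transform_within_open[where S = "{0<..}"])
      (use assms in \<open>auto simp: deriv_root_fun\<close>)
qed

lemma smoothing_has_derivative_0:
  assumes "0 < \<delta>"
  shows "(smoothing p \<delta> has_real_derivative coeff_C p \<delta>) (at 0 within {0..})"
\<comment> \<open>Within distance \<delta> of 0 the smoothing is the cubic, whose linear coefficient
  is its slope at 0.\<close>
proof (rule has_field_derivative_transform_within[where d = \<delta>])
  show "((\<lambda>w. coeff_A p \<delta> * w^3 + coeff_B p \<delta> * w^2 + coeff_C p \<delta> * w)
      has_real_derivative coeff_C p \<delta>) (at 0 within {0..})"
    by (auto intro!: derivative_eq_intros)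
qed (use assms in \<open>auto simp: smoothing_def dist_real_def\<close>)

lemma matches_slope_iff_slope:
  assumes "0 < \<delta>"
  shows "matches_slope p \<delta> l \<longleftrightarrow> 0 < l \<and> p * l powr (p - 1) = coeff_C p \<delta>"
proof -
  \<comment> \<open>0 is a limit point of \<open>{0..}\<close>, so a one-sided derivative there is
    unique.\<close>
  have "at (0::real) within {0..} \<noteq> bot"
    by (simp add: at_within_Ici_at_right)
  then have "c = coeff_C p \<delta>"
    if "(smoothing p \<delta> has_real_derivative c) (at 0 within {0..})" for c
    using that smoothing_has_derivative_0[OF assms, of p]
    unfolding has_field_derivative_iff by (rule tendsto_unique)
  then show ?thesis
    unfolding matches_slope_def
    using smoothing_has_derivative_0[OF assms, of p] deriv_root_fun[of l p] by metis
qed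

lemma powr_eq_iff_eq_powr:
  fixes a x y :: real
  assumes "a \<noteq> 0" "0 < x" "0 < y"
  shows "x powr a = y \<longleftrightarrow> x = y powr (1 / a)"
  using assms by (auto simp: powr_powr)

lemma matches_slope_iff:
  assumes "0 < p" "p < 1" "0 < \<delta>"
  shows "matches_slope p \<delta> l \<longleftrightarrow> l = \<delta> * ((p^2 - 5*p + 6) / (2*p)) powr (1 / (p - 1))"
proof -
  define K where "K = (p^2 - 5*p + 6) / (2*p)"
  \<comment> \<open>The factorization shows the sign: both factors are positive for
    \<open>p < 1\<close>.\<close>
  have "p^2 - 5*p + 6 = (2 - p) * (3 - p)"
    by (simp add: power2_eq_square algebra_simps)
  then have K: "0 < K"
    using assms by (simp add: K_def)
  have C: "coeff_C p \<delta> = p * (\<delta> powr (p - 1) * K)"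
    using assms by (simp add: coeff_C_def K_def)
  have "(\<delta> powr (p - 1) * K) powr (1 / (p - 1)) = \<delta> * K powr (1 / (p - 1))"
    using assms K by (simp add: powr_mult powr_powr)
  then have "p * l powr (p - 1) = coeff_C p \<delta> \<longleftrightarrow> l = \<delta> * K powr (1 / (p - 1))" if "0 < l"
    using powr_eq_iff_eq_powr[of "p - 1" l "\<delta> powr (p - 1) * K"] that assms K
    by (simp add: C)
  moreover have "0 < \<delta> * K powr (1 / (p - 1))"
    using assms K by simp
  ultimately show ?thesis
    unfolding matches_slope_iff_slope[OF assms(3)] K_def by blast
qed

text \<open>Makes \<open>the_inv_into\<close> in the theorem a genuine inverse of f'; the exponent
  \<open>p - 1\<close> is nonzero, so the power can be undone.\<close>

lemma inj_on_deriv_root_fun: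
  assumes "0 < p" "p < 1"
  shows "inj_on (deriv (root_fun p)) {0<..}"
proof (rule inj_onI)
  fix x y :: real
  assume "x \<in> {0<..}" "y \<in> {0<..}" "deriv (root_fun p) x = deriv (root_fun p) y"
  then show "x = y"
    using assms by (auto simp: deriv_root_fun powr_eq_iff_eq_powr powr_powr)
qed

text \<open>For a cubic without constant term that agrees with f to second order at \<delta>, this
  combination cancels the cubic and quadratic coefficients and leaves the linear one.\<close>

lemma coeff_C_eq_derivs:
  assumes "0 < \<delta>"
  shows "3 * root_fun p \<delta> / \<delta> - 2 * deriv (root_fun p) \<delta>
      + \<delta> * deriv (deriv (root_fun p)) \<delta> / 2 = coeff_C p \<delta>"
proof -
  have "\<delta> powr p = \<delta>^2 * \<delta> powr (p - 2)" "\<delta> powr (p - 1) = \<delta> * \<delta> powr (p - 2)"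
    using assms by (simp_all add: powr_diff power2_eq_square)
  then show ?thesis
    using assms unfolding deriv_root_fun[OF assms] deriv2_root_fun[OF assms]
    by (simp add: root_fun_def coeff_C_def field_simps power2_eq_square)
qed

text \<open>The left sides are the first and second derivatives of the cubic at \<delta>. After the
  common factor \<open>\<delta> powr (p - 3)\<close> is taken out, both claims are polynomial
  identities.\<close>

lemma smoothing_deriv_match:
  assumes "0 < \<delta>"
  shows "3 * coeff_A p \<delta> * \<delta>^2 + 2 * coeff_B p \<delta> * \<delta> + coeff_C p \<delta> = p * \<delta> powr (p - 1)"
    and "6 * coeff_A p \<delta> * \<delta> + 2 * coeff_B p \<delta> = p * (p - 1) * \<delta> powr (p - 2)"
proof -
  have *: "\<delta> powr (p - 1) = \<delta>^2 * \<delta> powr (p - 3)" "\<delta> powr (p - 2) = \<delta> * \<delta> powr (p - 3)"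
    using assms by (simp_all add: powr_diff power2_eq_square power3_eq_cube)
  show "3 * coeff_A p \<delta> * \<delta>^2 + 2 * coeff_B p \<delta> * \<delta> + coeff_C p \<delta> = p * \<delta> powr (p - 1)"
    unfolding coeff_A_def coeff_B_def coeff_C_def *
    by (simp add: field_simps power2_eq_square)
  show "6 * coeff_A p \<delta> * \<delta> + 2 * coeff_B p \<delta> = p * (p - 1) * \<delta> powr (p - 2)"
    unfolding coeff_A_def coeff_B_def *
    by (simp add: field_simps power2_eq_square)
qed

lemma shifted_root_le_smoothing:
  assumes p: "0 < p" "p < 1" and "0 < \<delta>" and l: "matches_slope p \<delta> l" and w: "w \<in> {0<..<\<delta>}"
  shows "root_fun p (w + l) - root_fun p l \<le> smoothing p \<delta> w"
proof -
  have l0: "0 < l" and lC: "p * l powr (p - 1) = coeff_C p \<delta>"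
    using l by (auto simp: matches_slope_iff_slope[OF \<open>0 < \<delta>\<close>])
  define A B C where "A = coeff_A p \<delta>" and "B = coeff_B p \<delta>" and "C = coeff_C p \<delta>"
  define D where "D = (\<lambda>w. A * w^3 + B * w^2 + C * w - ((w + l) powr p - l powr p))"
  define D1 where "D1 = (\<lambda>w. 3 * A * w^2 + 2 * B * w + C - p * (w + l) powr (p - 1))"
  define D2 where "D2 = (\<lambda>w. 6 * A * w + 2 * B - p * (p - 1) * (w + l) powr (p - 2))"
  define D3 where "D3 = (\<lambda>w. 6 * A - p * (p - 1) * (p - 2) * (w + l) powr (p - 3))"
  define D4 where "D4 = (\<lambda>w. - (p * (p - 1) * (p - 2) * (p - 3) * (w + l) powr (p - 4)))"
  \<comment> \<open>As \<open>l\<close> is positive, \<open>x + l\<close> stays positive even at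
    \<open>x = 0\<close>, so two-sided derivatives exist on the closed interval.\<close>
  have d1: "(D has_real_derivative D1 x) (at x)" if "0 \<le> x" for x
    unfolding D_def D1_def using that l0
    by (auto intro!: derivative_eq_intros simp: algebra_simps)
  have d2: "(D1 has_real_derivative D2 x) (at x)" if "0 \<le> x" for x
    unfolding D1_def D2_def using that l0
    by (auto intro!: derivative_eq_intros simp: algebra_simps)
  have d3: "(D2 has_real_derivative D3 x) (at x)" if "0 \<le> x" for x
    unfolding D2_def D3_def using that l0
    by (auto intro!: derivative_eq_intros simp: algebra_simps)
  have d4: "(D3 has_real_derivative D4 x) (at x)" if "0 \<le> x" for x
    unfolding D3_def D4_def using that l0
    by (auto intro!: derivative_eq_intros simp: algebra_simps)
  \<comment> \<open>One positive and three negative factors; the minus sign in \<open>D4\<close>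
    turns this around.\<close>
  have "p * (p - 1) * (p - 2) * (p - 3) \<le> 0"
    using p by (simp add: mult_le_0_iff zero_le_mult_iff)
  then have "0 \<le> D4 x" for x
    by (simp add: D4_def mult_le_0_iff)
  then have conv: "convex_on {0..\<delta>} D2"
    by (intro f''_ge0_imp_convex[of _ D2 D3 D4]) (auto intro: d3 d4)
  \<comment> \<open>Both exponents are negative. By the matching at \<delta>,
    \<open>D1 \<delta>\<close> and \<open>D2 \<delta>\<close> are the differences of these powers
    times \<open>p\<close> and \<open>p * (p - 1)\<close>, which have opposite signs.\<close>
  have "(\<delta> + l) powr (p - 1) \<le> \<delta> powr (p - 1)" "(\<delta> + l) powr (p - 2) \<le> \<delta> powr (p - 2)"
    using assms l0 by (auto intro!: powr_mono2')
  then have end1: "0 \<le> D1 \<delta>" and end2: "D2 \<delta> \<le> 0"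
    using p smoothing_deriv_match[OF \<open>0 < \<delta>\<close>, of p]
    by (auto simp: D1_def D2_def A_def B_def C_def mult_left_mono mult_left_mono_neg mult_le_0_iff)
  \<comment> \<open>This is where the choice of \<open>l\<close> enters: f'(l) is the slope of the
    cubic at 0.\<close>
  have "D1 0 = 0"
    using lC by (simp add: D1_def C_def)
  then have D1: "0 \<le> D1 x" if "x \<in> {0..\<delta>}" for x
    using nonneg_of_convex_deriv[OF conv, of D1] d2 end1 end2 that by auto
  have "D 0 \<le> D w"
  proof (rule DERIV_nonneg_imp_nondecreasing[where f = D])
    show "\<exists>y. (D has_real_derivative y) (at x) \<and> 0 \<le> y" if "0 \<le> x" "x \<le> w" for x
      using d1[of x] D1[of x] that w by auto
  qed (use w in simp)
  then show ?thesis
    using w l0 by (simp add: D_def smoothing_def root_fun_def A_def B_def C_def)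
qed

theorem theorem10:
  fixes q :: nat and p \<delta> :: real
  assumes "2 \<le> q" and "q \<le> 10000" and "p = 1 / real q" and "0 < \<delta>"
  shows "(\<exists>!l. matches_slope p \<delta> l)
    \<and> lambda_hat p \<delta> = the_inv_into {0<..} (deriv (root_fun p))
        (3 * root_fun p \<delta> / \<delta> - 2 * deriv (root_fun p) \<delta>
          + \<delta> * deriv (deriv (root_fun p)) \<delta> / 2)
    \<and> lambda_hat p \<delta> = \<delta> * ((p^2 - 5*p + 6) / (2*p)) powr (1 / (p - 1))
    \<and> (\<forall>w\<in>{0<..<\<delta>}.
         root_fun p (w + lambda_hat p \<delta>) - root_fun p (lambda_hat p \<delta>) \<le> smoothing p \<delta> w)"
proof -
  have p: "0 < p" "p < 1"
    using assms by auto
  note iff = matches_slope_iff[OF p \<open>0 < \<delta>\<close>]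
  have unique: "\<exists>!l. matches_slope p \<delta> l"
    by (simp add: iff)
  then have lambda: "matches_slope p \<delta> (lambda_hat p \<delta>)"
    unfolding lambda_hat_def by (rule theI')
  \<comment> \<open>The slope condition says that f' takes the value
    \<open>coeff_C p \<delta>\<close> at \<open>lambda_hat p \<delta>\<close>; injectivity inverts
    this.\<close>
  have "the_inv_into {0<..} (deriv (root_fun p)) (coeff_C p \<delta>) = lambda_hat p \<delta>"
    using lambda inj_on_deriv_root_fun[OF p]
    by (intro the_inv_into_f_eq)
      (auto simp: matches_slope_iff_slope[OF \<open>0 < \<delta>\<close>] deriv_root_fun)
  then show ?thesis
    using unique lambda shifted_root_le_smoothing[OF p \<open>0 < \<delta>\<close> lambda]
    by (auto simp: iff coeff_C_eq_derivs[OF \<open>0 < \<delta>\<close>])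
qed

end
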